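(* For any integers $v\ge w\ge t\ge 2$ with $w\le t^2$, $$M_t(w,v)=v-w+1.$$
   Context: A set system is a pair $(\mathcal{X},\mathcal{B})$ where $\mathcal{X}$ is a finite set of points and $\mathcal{B}$ is a collection (set) of subsets of $\mathcal{X}$ called blocks; its size is $|\mathcal{B}|$. $\binom{\mathcal{X}}{w}$ denotes the collection of all $w$-subsets of $\mathcal{X}$. A $t$-traceability scheme $t$-TS$(w,v)$ is a set system $(\mathcal{X},\mathcal{B})$ with $|\mathcal{X}|=v$ and $\mathcal{B}\subseteq\binom{\mathcal{X}}{w}$ such that for every choice of $s$ blocks $B_1,\ldots,B_s\in\mathcal{B}$ with $1\le s\le t$ and for any $w$-subset $T\subseteq\bigcup_{1\le j\le s}B_j$, there does not exist a block $B\in\mathcal{B}\setminus\{B_1,\ldots,B_s\}$ such that $|T\cap B|\ge|T\cap B_j|$ for all $1\le j\le s$. $M_t(w,v)$ denotes the maximum size of a $t$-TS$(w,v)$. *)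

theory Defs
  imports Main
begin

definition set_system :: "'a set \<Rightarrow> 'a set set \<Rightarrow> bool" where
  "set_system X \<B> \<longleftrightarrow> finite X \<and> \<B> \<subseteq> Pow X"

(* The chosen blocks B 1, ..., B s are not required to be distinct. *)
definition traceability_scheme ::
    "nat \<Rightarrow> nat \<Rightarrow> nat \<Rightarrow> 'a set \<Rightarrow> 'a set set \<Rightarrow> bool" where
  "traceability_scheme t w v X \<B> \<longleftrightarrow>
     set_system X \<B> \<and> card X = v \<and> \<B> \<subseteq> {A. A \<subseteq> X \<and> card A = w} \<and>
     (\<forall>s B T. 1 \<le> s \<and> s \<le> t \<and> (\<forall>j\<in>{1..s}. B j \<in> \<B>) \<and>
        T \<subseteq> (\<Union>j\<in>{1..s}. B j) \<and> card T = w \<longrightarrow>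
        \<not> (\<exists>B'\<in>\<B> - B ` {1..s}. \<forall>j\<in>{1..s}. card (T \<inter> B') \<ge> card (T \<inter> B j)))"

(* Fixing the type of points to nat loses no generality: see card_in_scheme_sizes. *)
definition scheme_sizes :: "nat \<Rightarrow> nat \<Rightarrow> nat \<Rightarrow> nat set" where
  "scheme_sizes t w v =
     {card \<B> | (X :: nat set) \<B>. traceability_scheme t w v X \<B>}"

lemma card_in_scheme_sizes:
  fixes X :: "'a set"
  assumes "traceability_scheme t w v X \<B>"
  shows "card \<B> \<in> scheme_sizes t w v"
proof -
  have fin: "finite X" and sub: "\<B> \<subseteq> Pow X" and cX: "card X = v"
    and cB: "\<And>A. A \<in> \<B> \<Longrightarrow> A \<subseteq> X \<and> card A = w"
    using assms unfolding traceability_scheme_def set_system_def by auto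
  have trace: "\<exists>j\<in>{1..s}. card (T \<inter> B') < card (T \<inter> B j)"
    if "1 \<le> s" "s \<le> t" "\<forall>j\<in>{1..s}. B j \<in> \<B>" "T \<subseteq> (\<Union>j\<in>{1..s}. B j)" "card T = w"
      "B' \<in> \<B>" "B' \<notin> B ` {1..s}" for s B T B'
  proof -
    have "\<not> (\<exists>B'\<in>\<B> - B ` {1..s}. \<forall>j\<in>{1..s}. card (T \<inter> B j) \<le> card (T \<inter> B'))"
      using assms that(1-5) unfolding traceability_scheme_def by blast
    then show ?thesis
      using that(6,7) by (meson DiffI not_le)
  qed
  obtain f :: "'a \<Rightarrow> nat" where inj: "inj_on f X"
    using finite_imp_inj_to_nat_seg[OF fin] by blast
  define g where "g = the_inv_into X f"
  have gf: "g (f x) = x" if "x \<in> X" for x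
    using that inj by (simp add: g_def the_inv_into_f_f)
  have injg: "inj_on g (f ` X)"
    using gf by (auto simp: inj_on_def)
  have gfA: "g ` (f ` A) = A" if "A \<subseteq> X" for A
    using that gf by (force simp: image_iff)
  have inj_blocks: "inj_on (image f) \<B>"
    using inj_on_subset[OF inj_on_image_Pow[OF inj] sub] .
  have "traceability_scheme t w v (f ` X) (image f ` \<B>)"
    unfolding traceability_scheme_def set_system_def
  proof (intro conjI allI impI notI)
    show "finite (f ` X)" using fin by simp
    show "image f ` \<B> \<subseteq> Pow (f ` X)" using sub by auto
    show "card (f ` X) = v" using inj cX by (simp add: card_image)
    show "image f ` \<B> \<subseteq> {A. A \<subseteq> f ` X \<and> card A = w}"
    proof
      fix C assume "C \<in> image f ` \<B>"
      then obtain A where A: "A \<in> \<B>" "C = f ` A" by auto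
      then show "C \<in> {A. A \<subseteq> f ` X \<and> card A = w}"
        using cB[OF A(1)] inj by (auto simp: card_image inj_on_subset)
    qed
  next
    fix s :: nat and B :: "nat \<Rightarrow> nat set" and T :: "nat set"
    assume H: "1 \<le> s \<and> s \<le> t \<and> (\<forall>j\<in>{1..s}. B j \<in> image f ` \<B>) \<and>
        T \<subseteq> (\<Union>j\<in>{1..s}. B j) \<and> card T = w"
    assume "\<exists>B'\<in>image f ` \<B> - B ` {1..s}. \<forall>j\<in>{1..s}. card (T \<inter> B j) \<le> card (T \<inter> B')"
    then obtain A' where A': "A' \<in> \<B>" "f ` A' \<notin> B ` {1..s}"
      and le: "\<And>j. j \<in> {1..s} \<Longrightarrow> card (T \<inter> B j) \<le> card (T \<inter> f ` A')" by auto
    have "\<forall>j\<in>{1..s}. \<exists>A\<in>\<B>. B j = f ` A" using H by blast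
    then obtain A where A: "\<And>j. j \<in> {1..s} \<Longrightarrow> A j \<in> \<B> \<and> B j = f ` A j" by metis
    have TX: "T \<subseteq> f ` X"
    proof
      fix x assume "x \<in> T"
      then obtain j where j: "j \<in> {1..s}" "x \<in> B j" using H by blast
      then have "x \<in> f ` A j" "A j \<subseteq> X" using A[OF j(1)] cB by auto
      then show "x \<in> f ` X" by auto
    qed
    have cap: "card (g ` T \<inter> D) = card (T \<inter> f ` D)" if "D \<subseteq> X" for D
    proof -
      have "g ` (T \<inter> f ` D) = g ` T \<inter> g ` f ` D"
        by (rule inj_on_image_Int[OF injg TX image_mono[OF that]])
      then show ?thesis
        using gfA[OF that] card_image[OF inj_on_subset[OF injg, of "T \<inter> f ` D"]] TX by force
    qed
    have "\<exists>j\<in>{1..s}. card (g ` T \<inter> A') < card (g ` T \<inter> A j)"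
    proof (rule trace)
      show "1 \<le> s" "s \<le> t" using H by auto
      show "\<forall>j\<in>{1..s}. A j \<in> \<B>" using A by auto
      have "g ` T \<subseteq> g ` (\<Union>j\<in>{1..s}. B j)" using H by blast
      also have "\<dots> = (\<Union>j\<in>{1..s}. g ` f ` A j)" 
        using A unfolding image_UN by (intro SUP_cong) auto
      also have "\<dots> = (\<Union>j\<in>{1..s}. A j)" 
        using gfA[OF conjunct1[OF cB]] A by (intro SUP_cong) simp_all
      finally show "g ` T \<subseteq> (\<Union>j\<in>{1..s}. A j)" .
      show "card (g ` T) = w" using H card_image[OF inj_on_subset[OF injg TX]] by simp
      show "A' \<in> \<B>" by (fact A')
      show "A' \<notin> A ` {1..s}" 
      proof
        assume "A' \<in> A ` {1..s}"
        then obtain j where "j \<in> {1..s}" "A' = A j" by blast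
        then have "f ` A' = B j" using A by simp
        then show False using A'(2) \<open>j \<in> {1..s}\<close> by blast
      qed
    qed
    then obtain j where j: "j \<in> {1..s}" "card (g ` T \<inter> A') < card (g ` T \<inter> A j)" by blast
    moreover have "A' \<subseteq> X" "A j \<subseteq> X" using A' A[OF j(1)] cB by auto
    ultimately show False using le[OF j(1)] A[OF j(1)] cap by simp
  qed
  moreover have "card (image f ` \<B>) = card \<B>" using inj_blocks by (rule card_image)
  ultimately show ?thesis unfolding scheme_sizes_def by force
qed

lemma scheme_sizes_finite_nonempty:
  "finite (scheme_sizes t w v)" "scheme_sizes t w v \<noteq> {}"
proof -
  have "card \<B> \<le> 2 ^ v" if "traceability_scheme t w v X \<B>" for X :: "nat set" and \<B>
    using that card_mono[of "Pow X" \<B>]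
    by (auto simp: traceability_scheme_def set_system_def card_Pow)
  then have "scheme_sizes t w v \<subseteq> {..2 ^ v}"
    by (auto simp: scheme_sizes_def)
  then show "finite (scheme_sizes t w v)"
    using finite_subset by blast
  have "traceability_scheme t w v {..<v} {}"
    by (auto simp: traceability_scheme_def set_system_def)
  then show "scheme_sizes t w v \<noteq> {}"
    unfolding scheme_sizes_def by blast
qed

definition max_scheme_size :: "nat \<Rightarrow> nat \<Rightarrow> nat \<Rightarrow> nat" where
  "max_scheme_size t w v = Max (scheme_sizes t w v)"

end

theory Submission imports Defs begin

text \<open>
  The lower bound is a sunflower whose kernel has \<open>w - 1\<close> points and whose petals are single points.
  For the upper bound it suffices that every block \<open>B\<close> has a point lying in no other block, since
  these points for the blocks other than \<open>B\<close> are distinct and avoid \<open>B\<close>.  If \<open>B\<close> has no such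
  point, take a minimal cover of \<open>B\<close> by other blocks.  A cover by at most \<open>t\<close> blocks frames \<open>B\<close>
  directly, with \<open>T = B\<close>.  Otherwise pick \<open>t\<close> blocks of the cover; by minimality, each contains a
  point of \<open>B\<close> missed by the others.  If each of them has at least \<open>t - 1\<close> points outside \<open>B\<close> and
  the other chosen blocks, then they can frame \<open>B\<close>, because \<open>w - t \<le> t (t - 1)\<close>.  If not, the
  chosen block with the fewest such points is framed by \<open>B\<close> and the remaining \<open>t - 1\<close> blocks.
\<close>

section \<open>Basic properties of traceability schemes\<close>

lemma traceability_scheme_finite:
  assumes "traceability_scheme t w v X \<B>"
  shows "finite X" "finite \<B>"
proof -
  show fin: "finite X"
    using assms by (simp add: traceability_scheme_def set_system_def)
  have "\<B> \<subseteq> Pow X"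
    using assms by (simp add: traceability_scheme_def set_system_def)
  then show "finite \<B>"
    using fin finite_subset by blast
qed

lemma traceability_scheme_block:
  assumes "traceability_scheme t w v X \<B>" "A \<in> \<B>"
  shows "A \<subseteq> X" "card A = w" "finite A"
proof -
  have "\<B> \<subseteq> {A. A \<subseteq> X \<and> card A = w}"
    using assms(1) by (simp add: traceability_scheme_def)
  then show A: "A \<subseteq> X" and "card A = w"
    using assms(2) by auto
  show "finite A"
    using A traceability_scheme_finite(1)[OF assms(1)] by (rule finite_subset)
qed

text \<open>Enumerating \<open>\<C>\<close> injectively turns the indexed, possibly repeating choice
  of blocks in the definition into a set of blocks. The contradictions behind the upper bound come
  from this form.\<close>

lemma traceability_scheme_not_framed:
  assumes ts: "traceability_scheme t w v X \<B>"
    and sub: "\<C> \<subseteq> \<B>" "\<C> \<noteq> {}" "card \<C> \<le> t"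
    and T: "T \<subseteq> \<Union>\<C>" "card T = w" and F: "F \<in> \<B>" "F \<notin> \<C>"
  shows "\<exists>A\<in>\<C>. card (T \<inter> F) < card (T \<inter> A)"
proof -
  have fin: "finite \<C>"
    using sub(1) traceability_scheme_finite(2)[OF ts] finite_subset by blast
  obtain B where "bij_betw B {1..card \<C>} \<C>"
    using ex_bij_betw_nat_finite_1[OF fin] by blast
  then have im: "B ` {1..card \<C>} = \<C>"
    by (rule bij_betw_imp_surj_on)
  have "1 \<le> card \<C>"
    using fin sub(2) by (simp add: Suc_le_eq card_gt_0_iff)
  moreover have "\<forall>j\<in>{1..card \<C>}. B j \<in> \<B>"
    using im sub(1) by blast
  moreover have "T \<subseteq> (\<Union>j\<in>{1..card \<C>}. B j)"
    using T(1) im by simp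
  ultimately have "\<not> (\<exists>B'\<in>\<B> - B ` {1..card \<C>}.
      \<forall>j\<in>{1..card \<C>}. card (T \<inter> B j) \<le> card (T \<inter> B'))"
    using ts sub(3) T(2) unfolding traceability_scheme_def by blast
  then have "\<not> (\<forall>j\<in>{1..card \<C>}. card (T \<inter> B j) \<le> card (T \<inter> F))"
    using F im by blast
  then show ?thesis
    using im by (metis imageI not_le)
qed

section \<open>Upper bound: minimal covers, framing and own points\<close>

lemma minimal_cover:
  assumes "finite \<B>" "B \<subseteq> \<Union>\<B>"
  obtains \<M> where "\<M> \<subseteq> \<B>" "B \<subseteq> \<Union>\<M>"
    "\<And>A. A \<in> \<M> \<Longrightarrow> \<not> B \<subseteq> \<Union>(\<M> - {A})"
proof -
  let ?S = "{\<M>. \<M> \<subseteq> \<B> \<and> B \<subseteq> \<Union>\<M>}"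
  have fin: "finite ?S" and ne: "?S \<noteq> {}"
    using assms by auto
  obtain \<M> where \<M>: "\<M> \<in> ?S" and min: "\<forall>\<N>\<in>?S. \<N> \<subseteq> \<M> \<longrightarrow> \<M> = \<N>"
    using finite_has_minimal[OF fin ne] by (rule bexE)
  show ?thesis
  proof (rule that)
    show "\<M> \<subseteq> \<B>" "B \<subseteq> \<Union>\<M>"
      using \<M> by auto
    fix A assume A: "A \<in> \<M>"
    show "\<not> B \<subseteq> \<Union>(\<M> - {A})"
    proof
      assume "B \<subseteq> \<Union>(\<M> - {A})"
      then have "\<M> - {A} \<in> ?S"
        using \<M> by auto
      then have "\<M> = \<M> - {A}"
        using min by (auto dest: bspec)
      then show False
        using A by blast
    qed
  qed
qed

text \<open>Each \<open>x A\<close> is a point of \<open>B\<close> that \<open>A\<close> alone among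
  the blocks of \<open>\<A>\<close> contains. When \<open>B\<close> is framed, a chosen block misses
  \<open>t - 1\<close> such points and gains at most \<open>t - 1\<close> others; when
  \<open>F\<close> in \<open>\<A>\<close> is framed, another chosen block misses \<open>x F\<close>
  and gains at most one point.\<close>

lemma traceability_scheme_no_private_pieces:
  assumes ts: "traceability_scheme t w v X \<B>" and t: "2 \<le> t" "w \<le> t\<^sup>2"
    and B: "B \<in> \<B>" and \<A>: "\<A> \<subseteq> \<B> - {B}" "card \<A> = t"
    and piece: "\<And>A. A \<in> \<A> \<Longrightarrow> x A \<in> B \<inter> A"
      "\<And>A A'. A \<in> \<A> \<Longrightarrow> A' \<in> \<A> \<Longrightarrow> A \<noteq> A' \<Longrightarrow> x A \<notin> A'"
  shows False
proof -
  note fin = traceability_scheme_finite[OF ts]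
  have finA: "finite \<A>"
    using \<A>(1) fin(2) finite_subset by blast
  have neA: "\<A> \<noteq> {}"
    using \<A>(2) t(1) by auto
  have block: "finite A" "card A = w" if "A \<in> \<B>" for A
    using traceability_scheme_block[OF ts that] by auto
  have blockA: "finite A" "card A = w" "A \<in> \<B>" "A \<noteq> B" if "A \<in> \<A>" for A
    using block[of A] that \<A>(1) by auto
  have injx: "inj_on x \<A>"
  proof (rule inj_onI, rule ccontr)
    fix A A' assume "A \<in> \<A>" "A' \<in> \<A>" "x A = x A'" "A \<noteq> A'"
    then show False using piece(1)[of A'] piece(2)[of A A'] by auto
  qed
  \<comment> \<open>For \<open>A\<close> in \<open>\<A>\<close> these sets are pairwise disjoint and
    avoid \<open>B\<close>, so a point taken from \<open>P A\<close> counts for \<open>A\<close> and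
    for no other block in play.\<close>
  define P where "P A = A - B - \<Union>(\<A> - {A})" for A
  have P_disj: "P A \<inter> A' = {}" if "A' \<in> \<A>" "A \<noteq> A'" for A A'
    using that unfolding P_def by blast
  have P_sub: "P A \<subseteq> A" and P_B: "P A \<inter> B = {}" for A
    unfolding P_def by auto
  have finP: "finite (P A)" if "A \<in> \<A>" for A
    using P_sub blockA(1)[OF that] finite_subset by blast
  show False
  proof (cases "\<forall>A\<in>\<A>. t - 1 \<le> card (P A)")
    case True
    \<comment> \<open>Cutting \<open>P A\<close> down to exactly \<open>t - 1\<close> points caps
      what one block can gain, while leaving \<open>t * (t - 1)\<close> points in total.\<close>
    then have "\<forall>A\<in>\<A>. \<exists>Q. Q \<subseteq> P A \<and> card Q = t - 1"
      by (meson obtain_subset_with_card_n)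
    then obtain Q where Q: "\<And>A. A \<in> \<A> \<Longrightarrow> Q A \<subseteq> P A" "\<And>A. A \<in> \<A> \<Longrightarrow> card (Q A) = t - 1"
      by metis
    have finQ: "finite (Q A)" if "A \<in> \<A>" for A
      using Q(1) finP that finite_subset by blast
    have "card (\<Union>A\<in>\<A>. Q A) = (\<Sum>A\<in>\<A>. card (Q A))"
    proof (rule card_UN_disjoint)
      show "\<forall>A\<in>\<A>. \<forall>A'\<in>\<A>. A \<noteq> A' \<longrightarrow> Q A \<inter> Q A' = {}"
      proof (intro ballI impI)
        fix A A' assume A: "A \<in> \<A>" "A' \<in> \<A>" "A \<noteq> A'"
        then show "Q A \<inter> Q A' = {}"
          using Q(1)[OF A(1)] Q(1)[OF A(2)] P_disj[OF A(2,3)] P_sub[of A'] by blast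
      qed
    qed (use finA finQ in auto)
    then have cardQ: "card (\<Union>A\<in>\<A>. Q A) = t * (t - 1)"
      using Q(2) \<A>(2) by simp
    define C where "C = B \<inter> \<Union>\<A>"
    have finC: "finite C" and Cw: "card C \<le> w"
      using block[OF B] card_mono[of B C] by (auto simp: C_def)
    have "x ` \<A> \<subseteq> C"
      using piece(1) by (auto simp: C_def)
    then have "t \<le> card C"
      using card_mono[OF finC] card_image[OF injx] \<A>(2) by metis
    \<comment> \<open>The bound on \<open>w\<close> enters here:
      \<open>w - card C \<le> t\<^sup>2 - t\<close>, so the sets \<open>Q A\<close> can fill
      \<open>C\<close> up to \<open>w\<close> points.\<close>
    then have "w - card C \<le> card (\<Union>A\<in>\<A>. Q A)"
      using t(2) by (simp add: cardQ power2_eq_square diff_mult_distrib2)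
    then obtain D where D: "D \<subseteq> (\<Union>A\<in>\<A>. Q A)" "card D = w - card C" "finite D"
      by (meson obtain_subset_with_card_n)
    have DB: "D \<inter> B = {}"
      using D(1) Q(1) P_B by fast
    have "\<exists>A\<in>\<A>. card ((C \<union> D) \<inter> B) < card ((C \<union> D) \<inter> A)"
    proof (rule traceability_scheme_not_framed[OF ts])
      show "C \<union> D \<subseteq> \<Union>\<A>"
        using D(1) Q(1) P_sub unfolding C_def by fast
      have "C \<inter> D = {}"
        using DB C_def by blast
      then show "card (C \<union> D) = w"
        using finC D(2,3) Cw by (simp add: card_Un_disjoint)
    qed (use \<A> neA B in auto)
    then obtain A where A: "A \<in> \<A>" "card ((C \<union> D) \<inter> B) < card ((C \<union> D) \<inter> A)"
      by blast
    have "(C \<union> D) \<inter> B = C"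
      using DB by (auto simp: C_def)
    then have less: "card C < card ((C \<union> D) \<inter> A)"
      using A(2) by simp
    have "D \<inter> A \<subseteq> Q A"
    proof
      fix z assume z: "z \<in> D \<inter> A"
      then obtain A' where A': "A' \<in> \<A>" "z \<in> Q A'"
        using D(1) by blast
      then have "z \<in> P A'"
        using Q(1) by blast
      then have "A' = A"
        using P_disj[OF A(1), of A'] z by blast
      then show "z \<in> Q A"
        using A'(2) by simp
    qed
    then have DA: "card (D \<inter> A) \<le> t - 1"
      using card_mono[OF finQ[OF A(1)]] Q(2)[OF A(1)] by metis
    \<comment> \<open>Inside \<open>C\<close>, the block \<open>A\<close> misses the
      \<open>t - 1\<close> points belonging to the other chosen blocks, which offsets its gain from
      \<open>D\<close>.\<close>
    have "x ` (\<A> - {A}) \<union> (C \<inter> A) \<subseteq> C" "x ` (\<A> - {A}) \<inter> (C \<inter> A) = {}"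
      using piece A(1) by (auto simp: C_def)
    then have "card (x ` (\<A> - {A})) + card (C \<inter> A) \<le> card C"
      using finA finC card_mono[OF finC, of "x ` (\<A> - {A}) \<union> (C \<inter> A)"]
      by (simp add: card_Un_disjoint)
    moreover have "card (x ` (\<A> - {A})) = t - 1"
      using card_image[OF inj_on_subset[OF injx, of "\<A> - {A}"]] A(1) \<A>(2) finA by simp
    moreover have "card ((C \<union> D) \<inter> A) \<le> card (C \<inter> A) + card (D \<inter> A)"
      by (simp add: Int_Un_distrib2 card_Un_le)
    ultimately show False
      using less DA by linarith
  next
    case False
    \<comment> \<open>Minimality serves twice: \<open>P F\<close> has fewer than
      \<open>t - 1\<close> points, and if \<open>P F\<close> is nonempty then so is every
      \<open>P A\<close>.\<close>
    obtain F where F: "F \<in> \<A>" and minF: "\<And>A. A \<in> \<A> \<Longrightarrow> card (P F) \<le> card (P A)"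
      using that[OF arg_min_if_finite(1)[OF finA neA] arg_min_least[OF finA neA]] .
    have less_t: "card (P F) < t - 1"
      using False minF by (meson le_less_trans not_le)
    define \<C> where "\<C> = insert B (\<A> - {F})"
    \<comment> \<open>The coalition \<open>\<C>\<close> covers all of \<open>F\<close> except
      \<open>P F\<close>. The lost points are replaced by one point \<open>y A\<close> from each of
      equally many other chosen blocks, of which there are \<open>t - 1\<close>.\<close>
    define C where "C = F \<inter> \<Union>\<C>"
    have C_eq: "C = F - P F"
      unfolding C_def \<C>_def P_def by blast
    have finC: "finite C"
      using blockA(1)[OF F] by (simp add: C_eq)
    have cardC: "card C + card (P F) = w"
      using blockA(1,2)[OF F] P_sub[of F] finP[OF F] card_mono[of F "P F"]
      by (simp add: C_eq card_Diff_subset)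
    have "card (P F) \<le> card (\<A> - {F})"
      using less_t F \<A>(2) finA by simp
    then obtain \<D> where \<D>: "\<D> \<subseteq> \<A> - {F}" "card \<D> = card (P F)" "finite \<D>"
      by (meson obtain_subset_with_card_n)
    have "\<exists>y. y \<in> P A" if "A \<in> \<D>" for A
    proof -
      have "0 < card (P F)"
        using that \<D>(2,3) card_gt_0_iff by fastforce
      then show ?thesis
        using minF[of A] \<D>(1) that by (metis Diff_iff card.empty equals0I not_le subsetD)
    qed
    then obtain y where y: "\<And>A. A \<in> \<D> \<Longrightarrow> y A \<in> P A"
      by metis
    have only: "A = A'" if "A \<in> \<D>" "A' \<in> \<A>" "y A \<in> A'" for A A'
      using P_disj[OF that(2)] y[OF that(1)] that(3) by blast
    have injy: "inj_on y \<D>"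
    proof (rule inj_onI)
      fix A A' assume "A \<in> \<D>" "A' \<in> \<D>" "y A = y A'"
      then show "A = A'" using only[of A A'] y[of A'] P_sub \<D>(1) by auto
    qed
    have yF: "y ` \<D> \<inter> F = {}"
      using only F \<D>(1) by blast
    have yB: "y ` \<D> \<inter> B = {}"
      using y P_B by blast
    let ?T = "C \<union> y ` \<D>"
    have "\<exists>A\<in>\<C>. card (?T \<inter> F) < card (?T \<inter> A)"
    proof (rule traceability_scheme_not_framed[OF ts])
      show "\<C> \<subseteq> \<B>" "\<C> \<noteq> {}" "F \<in> \<B>" "F \<notin> \<C>"
        using \<A>(1) B F by (auto simp: \<C>_def)
      show "card \<C> \<le> t"
        using \<A> finA F t(1) card_insert_le_m1[of t "\<A> - {F}" B] by (simp add: \<C>_def)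
      show "?T \<subseteq> \<Union>\<C>"
      proof (intro Un_least image_subsetI)
        show "C \<subseteq> \<Union>\<C>"
          by (simp add: C_def)
        show "y A \<in> \<Union>\<C>" if "A \<in> \<D>" for A
          using y[OF that] P_sub[of A] \<D>(1) that by (intro UnionI[of A]) (auto simp: \<C>_def)
      qed
      have "C \<inter> y ` \<D> = {}"
        using yF C_def by blast
      then show "card ?T = w"
        using finC \<D>(2,3) cardC by (simp add: card_Un_disjoint card_image[OF injy])
    qed
    then obtain A where A: "A \<in> \<C>" "card (?T \<inter> F) < card (?T \<inter> A)"
      by blast
    have "?T \<inter> F = C"
      using yF by (auto simp: C_def)
    then have less: "card C < card (?T \<inter> A)"
      using A(2) by simp
    show False
    proof (cases "A = B")
      case True
      then have "?T \<inter> A \<subseteq> C"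
        using yB by blast
      then show False
        using less card_mono[OF finC] by (meson not_le)
    next
      case False
      then have A': "A \<in> \<A>" "A \<noteq> F"
        using A(1) by (auto simp: \<C>_def)
      have xC: "x F \<in> C" "x F \<notin> A"
        using piece(1)[OF F] piece(2)[OF F A'(1)] A'(2) by (auto simp: C_def \<C>_def)
      \<comment> \<open>Outside \<open>C\<close> only \<open>y A\<close> can lie in
        \<open>A\<close>. If \<open>A\<close> is not in \<open>\<D>\<close>, \<open>y A\<close> is
        an arbitrary value that merely enlarges the bounding set.\<close>
      have "?T \<inter> A \<subseteq> insert (y A) (C - {x F})"
        using only[OF _ A'(1)] xC(2) by blast
      then have "card (?T \<inter> A) \<le> card (insert (y A) (C - {x F}))"
        using finC by (intro card_mono) auto
      also have "\<dots> \<le> Suc (card (C - {x F}))"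
        by (simp add: card_insert_if finC)
      also have "\<dots> = card C"
        using card_Suc_Diff1[OF finC xC(1)] .
      finally show False
        using less by simp
    qed
  qed
qed

lemma traceability_scheme_own_point:
  assumes ts: "traceability_scheme t w v X \<B>" and t: "2 \<le> t" "t \<le> w" "w \<le> t\<^sup>2"
    and B: "B \<in> \<B>"
  shows "\<exists>x\<in>B. \<forall>A\<in>\<B> - {B}. x \<notin> A"
proof (rule ccontr)
  assume "\<not> ?thesis"
  then have "B \<subseteq> \<Union>(\<B> - {B})"
    by blast
  then obtain \<M> where \<M>: "\<M> \<subseteq> \<B> - {B}" "B \<subseteq> \<Union>\<M>"
    and min: "\<And>A. A \<in> \<M> \<Longrightarrow> \<not> B \<subseteq> \<Union>(\<M> - {A})"
    using minimal_cover[of "\<B> - {B}" B] traceability_scheme_finite(2)[OF ts] by auto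
  note blockB = traceability_scheme_block[OF ts B]
  show False
  proof (cases "card \<M> \<le> t")
    case True
    have "B \<noteq> {}"
      using blockB(2) t(1,2) by auto
    \<comment> \<open>With \<open>T = B\<close>, no block can meet \<open>T\<close> in more points
      than \<open>B\<close> itself does.\<close>
    then have "\<exists>A\<in>\<M>. card (B \<inter> B) < card (B \<inter> A)"
      using \<M> B blockB(2) True by (intro traceability_scheme_not_framed[OF ts]) auto
    then obtain A where "card B < card (B \<inter> A)"
      by auto
    then show False
      using card_mono[OF blockB(3) Int_lower1, of A] by simp
  next
    case False
    \<comment> \<open>Any \<open>t\<close> members will do: a point of \<open>B\<close> missed by
      all other members of \<open>\<M>\<close> is missed by those in \<open>\<A>\<close>.\<close>
    then obtain \<A> where \<A>: "\<A> \<subseteq> \<M>" "card \<A> = t"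
      by (meson nat_le_linear obtain_subset_with_card_n)
    have "\<exists>x. x \<in> B \<inter> A \<and> x \<notin> \<Union>(\<M> - {A})" if A: "A \<in> \<M>" for A
    proof -
      obtain x where x: "x \<in> B" "x \<notin> \<Union>(\<M> - {A})"
        using min[OF A] by (meson subsetI)
      moreover have "x \<in> \<Union>\<M>"
        using x(1) \<M>(2) by (rule subsetD[rotated])
      ultimately show ?thesis
        by auto
    qed
    then obtain x where x: "\<And>A. A \<in> \<M> \<Longrightarrow> x A \<in> B \<inter> A \<and> x A \<notin> \<Union>(\<M> - {A})"
      by metis
    show False
    proof (rule traceability_scheme_no_private_pieces[OF ts t(1,3) B _ \<A>(2)])
      show "\<A> \<subseteq> \<B> - {B}"
        using \<A>(1) \<M>(1) by blast
      show "x A \<in> B \<inter> A" if "A \<in> \<A>" for A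
        using x \<A>(1) that by blast
      show "x A \<notin> A'" if "A \<in> \<A>" "A' \<in> \<A>" "A \<noteq> A'" for A A'
        using x[of A] \<A>(1) that by blast
    qed
  qed
qed

text \<open>Own points inject the blocks other than a fixed \<open>B\<close> into the
  \<open>v - w\<close> points outside \<open>B\<close>; the summand 1 counts
  \<open>B\<close>.\<close>

lemma traceability_scheme_card_le:
  assumes ts: "traceability_scheme t w v X \<B>" and t: "2 \<le> t" "t \<le> w" "w \<le> t\<^sup>2"
  shows "card \<B> \<le> v - w + 1"
proof (cases "\<B> = {}")
  case False
  then obtain B where B: "B \<in> \<B>"
    by blast
  note fin = traceability_scheme_finite[OF ts]
  obtain p where p: "\<And>A. A \<in> \<B> \<Longrightarrow> p A \<in> A \<and> (\<forall>A'\<in>\<B> - {A}. p A \<notin> A')"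
    using traceability_scheme_own_point[OF ts t] by metis
  have "inj_on p (\<B> - {B})"
  proof (rule inj_onI, rule ccontr)
    fix A A' assume "A \<in> \<B> - {B}" "A' \<in> \<B> - {B}" "p A = p A'" "A \<noteq> A'"
    then show False using p[of A] p[of A'] by auto
  qed
  then have "card (\<B> - {B}) = card (p ` (\<B> - {B}))"
    by (simp add: card_image)
  also have "\<dots> \<le> card (X - B)"
    using p B traceability_scheme_block(1)[OF ts] fin(1) by (intro card_mono) blast+
  also have "\<dots> = v - w"
    using traceability_scheme_block[OF ts B] ts
    by (simp add: card_Diff_subset traceability_scheme_def)
  finally show ?thesis
    using B fin(2) by simp
qed simp

section \<open>Lower bound: sunflowers\<close>

text \<open>A set \<open>T\<close> larger than the kernel contains some petal point
  \<open>z\<close>, and the coalition must include the block of \<open>z\<close>. A block outside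
  the coalition has its petal point outside \<open>T\<close>, so it meets \<open>T\<close> only
  within \<open>K\<close> and falls short of the block of \<open>z\<close>.\<close>

lemma sunflower_traceability_scheme:
  assumes "finite K" "finite Y" "K \<inter> Y = {}"
  shows "traceability_scheme t (card K + 1) (card K + card Y) (K \<union> Y) ((\<lambda>y. insert y K) ` Y)"
  unfolding traceability_scheme_def set_system_def
proof (intro conjI allI impI notI)
  show "card (K \<union> Y) = card K + card Y"
    using assms by (simp add: card_Un_disjoint)
  show "(\<lambda>y. insert y K) ` Y \<subseteq> {A. A \<subseteq> K \<union> Y \<and> card A = card K + 1}"
  proof
    fix A assume "A \<in> (\<lambda>y. insert y K) ` Y"
    then obtain y where y: "y \<in> Y" "A = insert y K" by blast
    then have "y \<notin> K" using assms(3) by blast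
    then show "A \<in> {A. A \<subseteq> K \<union> Y \<and> card A = card K + 1}"
      using y assms(1) by auto
  qed
next
  fix s B T
  assume H: "1 \<le> s \<and> s \<le> t \<and> (\<forall>j\<in>{1..s}. B j \<in> (\<lambda>y. insert y K) ` Y) \<and>
    T \<subseteq> (\<Union>j\<in>{1..s}. B j) \<and> card T = card K + 1"
  assume "\<exists>B'\<in>(\<lambda>y. insert y K) ` Y - B ` {1..s}. \<forall>j\<in>{1..s}. card (T \<inter> B j) \<le> card (T \<inter> B')"
  then obtain y where y: "y \<in> Y" "insert y K \<notin> B ` {1..s}"
    and le: "\<And>j. j \<in> {1..s} \<Longrightarrow> card (T \<inter> B j) \<le> card (T \<inter> insert y K)" by blast
  \<comment> \<open>A point outside the kernel determines its block.\<close>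
  have petal: "B j = insert u K" if "j \<in> {1..s}" "u \<in> B j" "u \<notin> K" for j u
  proof -
    have "B j \<in> (\<lambda>y. insert y K) ` Y"
      using H that(1) by blast
    then show ?thesis
      using that(2,3) by auto
  qed
  have finT: "finite T"
    using H card_ge_0_finite[of T] by simp
  have "\<not> T \<subseteq> K"
    using H card_mono[OF assms(1), of T] by auto
  then obtain z where z: "z \<in> T" "z \<notin> K"
    by blast
  then obtain j where j: "j \<in> {1..s}" "z \<in> B j"
    using H by blast
  then have Bj: "B j = insert z K"
    using petal z(2) by blast
  have "y \<notin> T"
  proof
    assume "y \<in> T"
    then obtain i where i: "i \<in> {1..s}" "y \<in> B i"
      using H by blast
    have "y \<notin> K" using y(1) assms(3) by blast
    then have "B i = insert y K"
      using petal i by blast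
    then show False using y(2) i(1) by (metis imageI)
  qed
  then have "T \<inter> insert y K \<subseteq> T \<inter> B j" "z \<notin> T \<inter> insert y K" "z \<in> T \<inter> B j"
    using z by (auto simp: Bj)
  then have "T \<inter> insert y K \<subset> T \<inter> B j"
    by (metis psubsetI)
  then have "card (T \<inter> insert y K) < card (T \<inter> B j)"
    using finT by (intro psubset_card_mono) auto
  then show False
    using le[OF j(1)] by simp
next
  show "finite (K \<union> Y)"
    using assms by simp
  show "(\<lambda>y. insert y K) ` Y \<subseteq> Pow (K \<union> Y)"
    by blast
qed

theorem corollaryV2:
  fixes t w v :: nat
  assumes "2 \<le> t" and "t \<le> w" and "w \<le> v" and "w \<le> t\<^sup>2"
  shows "max_scheme_size t w v = v - w + 1"
  unfolding max_scheme_size_def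
proof (rule Max_eqI)
  show "finite (scheme_sizes t w v)"
    by (rule scheme_sizes_finite_nonempty)
  show "n \<le> v - w + 1" if "n \<in> scheme_sizes t w v" for n
    using that traceability_scheme_card_le assms(1,2,4) unfolding scheme_sizes_def by blast
  \<comment> \<open>A kernel of \<open>w - 1\<close> points leaves \<open>v - w + 1\<close> petals;
    the subtraction is exact because \<open>w\<close> is at least 2.\<close>
  let ?K = "{..<w - 1}" and ?Y = "{w - 1..<v}"
  have "traceability_scheme t (card ?K + 1) (card ?K + card ?Y) (?K \<union> ?Y) ((\<lambda>y. insert y ?K) ` ?Y)"
    by (rule sunflower_traceability_scheme) auto
  moreover have "card ?K + 1 = w" "card ?K + card ?Y = v"
    using assms(1-3) by auto
  moreover have "inj_on (\<lambda>y. insert y ?K) ?Y"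
    by (rule inj_onI) auto
  then have "card ((\<lambda>y. insert y ?K) ` ?Y) = v - w + 1"
    using assms(1-3) by (simp add: card_image)
  ultimately show "v - w + 1 \<in> scheme_sizes t w v"
    using card_in_scheme_sizes by metis
qed

end
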